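(* For integers $r\ge 2$, $k\ge 2$, let $W(r,k)$ be the van der Waerden number and write its base-$r$ expansion $W(r,k)=b_n r^n+b_{n-1}r^{n-1}+\cdots+b_0$, where $n=n(r,k)$ is a positive integer, $b_n\in\{1,\dots,r-1\}$ and $b_{n-1},\dots,b_0\in\{0,\dots,r-1\}$. Then for large $r$, $r^n$ and $W(r,k)$ one has $\log_r W(r,k)=n+O(1)$; that is, there exist constants $C,M>0$ such that $|\log_r W(r,k)-n(r,k)|\le C$ for all $r,k\ge 2$ for which $r$, $r^{n(r,k)}$ and $W(r,k)$ are all at least $M$.
   Context: The van der Waerden number $W(r,k)$ is the least positive integer $W$ such that every coloring of the integers $1,\dots,W$ with $r$ colors contains a monochromatic arithmetic progression with $k$ terms. *)

theory Defs
  imports Complex_Main "HOL-Library.FuncSet"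
begin

definition arith_prog :: "nat \<Rightarrow> nat \<Rightarrow> nat \<Rightarrow> nat set" where
  "arith_prog a d k = {a + i * d | i. i < k}"

definition has_mono_ap :: "(nat \<Rightarrow> nat) \<Rightarrow> nat \<Rightarrow> nat \<Rightarrow> bool" where
  "has_mono_ap c N k \<longleftrightarrow>
     (\<exists>a d j. d > 0 \<and> arith_prog a d k \<subseteq> {1..N} \<and> (\<forall>x\<in>arith_prog a d k. c x = j))"

text \<open>The \<open>r\<close> colors are \<open>0, \<dots>, r - 1\<close>. By van der Waerden's theorem a number as
  below exists for all \<open>r, k \<ge> 1\<close>, so \<open>LEAST\<close> then picks out an actual minimum.\<close>

definition vdW :: "nat \<Rightarrow> nat \<Rightarrow> nat" where
  "vdW r k = (LEAST W. W > 0 \<and> (\<forall>c \<in> {1..W} \<rightarrow> {..<r}. has_mono_ap c W k))"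

text \<open>\<open>is_base_expansion r m n b\<close>: the numeral \<open>b n \<dots> b 0\<close> is the base-\<open>r\<close> expansion of \<open>m\<close>,
  with leading digit \<open>b n \<noteq> 0\<close> and leading exponent \<open>n > 0\<close>. Values of \<open>b\<close> above \<open>n\<close>
  are irrelevant. Such an expansion exists iff \<open>m \<ge> r\<close> (for \<open>r \<ge> 2\<close>), and then \<open>n\<close> is
  unique; \<open>vdW r k > r\<close> whenever \<open>r, k \<ge> 2\<close>.\<close>

definition is_base_expansion :: "nat \<Rightarrow> nat \<Rightarrow> nat \<Rightarrow> (nat \<Rightarrow> nat) \<Rightarrow> bool" where
  "is_base_expansion r m n b \<longleftrightarrow>
     n > 0 \<and> b n \<in> {1..r - 1} \<and> (\<forall>i<n. b i \<in> {0..r - 1}) \<and> m = (\<Sum>i\<le>n. b i * r ^ i)"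

end

theory Submission
  imports Defs
begin

text \<open>Any number \<open>m\<close> with leading exponent \<open>n\<close> in base \<open>r\<close> satisfies
  \<open>r ^ n \<le> m < r ^ (n + 1)\<close>: the leading digit alone gives the lower bound, and even digits all
  equal to \<open>r - 1\<close> do not reach \<open>r ^ (n + 1)\<close>. Taking logarithms, \<open>n \<le> log r m < n + 1\<close>, so the
  error is less than \<open>1\<close> in every base \<open>r \<ge> 2\<close>.\<close>

text \<open>If the lower digits sum to less than \<open>r ^ n\<close>, they amount to less than one further unit
  in position \<open>n\<close>, and one unit more than \<open>b n\<close> is still at most \<open>r\<close>.\<close>

lemma digit_sum_less_power:
  fixes b :: "nat \<Rightarrow> nat"
  assumes "\<And>i. i < n \<Longrightarrow> b i < r"
  shows "(\<Sum>i<n. b i * r ^ i) < r ^ n"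
  using assms
proof (induction n)
  case 0
  show ?case by simp
next
  case (Suc n)
  have "(\<Sum>i<n. b i * r ^ i) < r ^ n"
    using Suc by simp
  then have "(\<Sum>i<Suc n. b i * r ^ i) < Suc (b n) * r ^ n"
    by simp
  also have "\<dots> \<le> r * r ^ n"
    using Suc.prems[of n] by (intro mult_right_mono) auto
  finally show ?case by simp
qed

lemma is_base_expansion_bounds:
  assumes "is_base_expansion r m n b"
  shows "r ^ n \<le> m" and "m < r ^ Suc n"
proof -
  have lead: "1 \<le> b n" "b n \<le> r - 1" and low: "\<And>i. i < n \<Longrightarrow> b i \<le> r - 1"
    and m: "m = (\<Sum>i\<le>n. b i * r ^ i)"
    using assms by (auto simp: is_base_expansion_def)
  have "r ^ n \<le> b n * r ^ n"
    using lead by simp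
  also have "\<dots> \<le> m"
    unfolding m by (rule member_le_sum) auto
  finally show "r ^ n \<le> m" .
  have "b i < r" if "i < Suc n" for i
    using that lead low[of i] by (cases "i = n") auto
  then show "m < r ^ Suc n"
    unfolding m lessThan_Suc_atMost[symmetric] by (rule digit_sum_less_power)
qed

lemma log_base_expansion:
  assumes r: "r \<ge> 2" and exp: "is_base_expansion r m n b"
  shows "real n \<le> log (real r) (real m)" and "log (real r) (real m) < real n + 1"
proof -
  have lower: "real r ^ n \<le> real m"
    using is_base_expansion_bounds(1)[OF exp] by (metis of_nat_le_iff of_nat_power)
  have upper: "real m < real r ^ Suc n"
    using is_base_expansion_bounds(2)[OF exp] by (metis of_nat_less_iff of_nat_power)
  have "0 < real r ^ n"
    using r by simp
  then have pos: "0 < real m"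
    using lower by linarith
  show "real n \<le> log (real r) (real m)"
    using r lower pos by (intro le_log_of_power) auto
  have "log (real r) (real m) < real (Suc n)"
    using r upper pos by (intro log_of_power_less) auto
  then show "log (real r) (real m) < real n + 1"
    by simp
qed

theorem theorem2p1:
  "\<exists>C M :: real. C > 0 \<and> M > 0 \<and>
     (\<forall>(r::nat) (k::nat) (n::nat) (b :: nat \<Rightarrow> nat).
        r \<ge> 2 \<longrightarrow> k \<ge> 2 \<longrightarrow> is_base_expansion r (vdW r k) n b \<longrightarrow>
        real r \<ge> M \<longrightarrow> real r ^ n \<ge> M \<longrightarrow> real (vdW r k) \<ge> M \<longrightarrow>
        \<bar>log (real r) (real (vdW r k)) - real n\<bar> \<le> C)"
proof -
  have "\<bar>log (real r) (real (vdW r k)) - real n\<bar> \<le> 1"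
    if "r \<ge> 2" "is_base_expansion r (vdW r k) n b" for r k n b
    using log_base_expansion[OF that] by linarith
  then show ?thesis
    by (intro exI[of _ 1]) auto
qed

end
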